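(* Presume that the input domain $D=\Delta^{p_1}\times\cdots\times\Delta^{p_\tau}$ is a product of $\tau$ simplices, and that $f(x)=\sum_{i=1}^\tau\sum_{j=1}^{p_i}w_{i,j}x_{i,j}+b$ is an affine function, taking both a strictly positive and a strictly negative value on $D$. Presume that, for each $i\in\{1,\dots,\tau\}$, the weights are sorted such that $w_{i,1}\le\cdots\le w_{i,p_i}$. Then an ideal formulation for $\{(x,y)\in D\times\mathbb{R}: y=\max\{0,f(x)\}\}$ is: $$\text{(a)}\quad y\ge w\cdot x+b,$$ $$\text{(b)}\quad y\le\sum_{i=1}^\tau\left(w_{i,J(i)}z+\sum_{j=J(i)+1}^{p_i}(w_{i,j}-w_{i,J(i)})x_{i,j}\right)+bz\quad\forall\text{ mappings }J:\{1,\dots,\tau\}\to\mathbb{Z}\text{ with }J(i)\in\{1,\dots,p_i\}\ \forall i,$$ $$\text{(c)}\quad(x,y,z)\in D\times\mathbb{R}_{\ge0}\times\{0,1\}.$$ Moreover, a most-violated constraint from the family (b), if one exists, can be identified in $\mathcal{O}(p_1+\cdots+p_\tau)$ time. Finally, none of the constraints from (b) are redundant.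
   Context: $\Delta^n=\{v\in\mathbb{R}^n_{\ge0}:\sum_iv_i=1\}$. Elements of $D$ are written $x=((x_{i,j})_{j=1}^{p_i})_{i=1}^\tau$ and $w\cdot x=\sum_{i,j}w_{i,j}x_{i,j}$; $\eta=p_1+\cdots+p_\tau$. MIP terminology: a (valid) MIP formulation of $S\subseteq\mathbb{R}^{\eta+1}$ consists of linear constraints on $(x,y,z)\in\mathbb{R}^\eta\times\mathbb{R}\times\mathbb{R}^q$ defining a polyhedron $Q$ (its LP relaxation), together with $z\in\{0,1\}^q$, such that $S=\operatorname{Proj}_{x,y}(Q\cap(\mathbb{R}^{\eta+1}\times\{0,1\}^q))$. It is ideal if every extreme point of $Q$ lies in $\mathbb{R}^{\eta+1}\times\{0,1\}^q$. Here $Q$ is obtained by replacing $z\in\{0,1\}$ with $z\in[0,1]$ in (c). Non-redundancy of a constraint of family (b): with respect to the polyhedron defined by the family (b), removing that constraint's halfspace (hence all constraints of (b), possibly for other mappings, defining the same halfspace) strictly enlarges the feasible set. *)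

theory Defs
  imports "HOL-Analysis.Analysis" "HOL-Analysis.Finite_Function_Topology"
begin

section \<open>Products of simplices\<close>

text \<open>
  A point of \<open>\<real>\<^sup>\<eta>\<close>, \<open>\<eta> = p 1 + \<dots> + p \<tau>\<close>, is a finitely supported function on pairs
  \<open>(i, j)\<close> whose support lies in \<open>idx \<tau> p\<close>. Since \<open>\<tau>\<close> and \<open>p\<close> are ordinary variables, all these
  spaces are realised as subspaces of one real vector space.
\<close>

type_synonym point = "(nat \<times> nat) \<Rightarrow>\<^sub>0 real"

definition idx :: "nat \<Rightarrow> (nat \<Rightarrow> nat) \<Rightarrow> (nat \<times> nat) set" where
  "idx \<tau> p = (SIGMA i:{1..\<tau>}. {1..p i})"

definition coord_space :: "nat \<Rightarrow> (nat \<Rightarrow> nat) \<Rightarrow> point set" where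
  "coord_space \<tau> p = {x. Poly_Mapping.keys x \<subseteq> idx \<tau> p}"

definition simplex_product :: "nat \<Rightarrow> (nat \<Rightarrow> nat) \<Rightarrow> point set" where
  "simplex_product \<tau> p = {x \<in> coord_space \<tau> p. \<forall>i\<in>{1..\<tau>}.
     (\<forall>j\<in>{1..p i}. 0 \<le> Poly_Mapping.lookup x (i, j)) \<and>
     (\<Sum>j=1..p i. Poly_Mapping.lookup x (i, j)) = 1}"

definition affine_fun :: "nat \<Rightarrow> (nat \<Rightarrow> nat) \<Rightarrow> (nat \<Rightarrow> nat \<Rightarrow> real) \<Rightarrow> real \<Rightarrow> point \<Rightarrow> real" where
  "affine_fun \<tau> p w b x = (\<Sum>i=1..\<tau>. \<Sum>j=1..p i. w i j * Poly_Mapping.lookup x (i, j)) + b"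

text \<open>
  The sign conditions make the domain nonempty, hence also force \<open>1 \<le> p i\<close> for \<open>i \<in> {1..\<tau>}\<close>, and
  \<open>1 \<le> \<tau>\<close>.
\<close>

definition relu_instance ::
    "nat \<Rightarrow> (nat \<Rightarrow> nat) \<Rightarrow> (nat \<Rightarrow> nat \<Rightarrow> real) \<Rightarrow> real \<Rightarrow> bool" where
  "relu_instance \<tau> p w b \<longleftrightarrow>
     (\<exists>x\<in>simplex_product \<tau> p. 0 < affine_fun \<tau> p w b x) \<and>
     (\<exists>x\<in>simplex_product \<tau> p. affine_fun \<tau> p w b x < 0) \<and>
     (\<forall>i\<in>{1..\<tau>}. mono_on {1..p i} (w i))"

definition relu_graph ::
    "nat \<Rightarrow> (nat \<Rightarrow> nat) \<Rightarrow> (nat \<Rightarrow> nat \<Rightarrow> real) \<Rightarrow> real \<Rightarrow> (point \<times> real) set" where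
  "relu_graph \<tau> p w b = {(x, y). x \<in> simplex_product \<tau> p \<and> y = max 0 (affine_fun \<tau> p w b x)}"


section \<open>MIP formulations\<close>

text \<open>
  Polyhedra inside a subspace \<open>V\<close>. The library constant \<open>polyhedron\<close> needs a Euclidean space as the
  ambient type. Every linear functional on \<open>V\<close> is the restriction of one on the whole space.
\<close>

definition polyhedron_in :: "'a::real_vector set \<Rightarrow> 'a set \<Rightarrow> bool" where
  "polyhedron_in V Q \<longleftrightarrow>
     (\<exists>F :: (('a \<Rightarrow> real) \<times> real) set. finite F \<and> (\<forall>(\<phi>, c)\<in>F. linear \<phi>) \<and>
        Q = {v \<in> V. \<forall>(\<phi>, c)\<in>F. \<phi> v \<le> c})"

definition binary :: "(real ^ 'q) set" where
  "binary = {z. \<forall>k. z $ k \<in> {0, 1}}"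

text \<open>
  \<open>V\<close> is the space of the variables \<open>x\<close>, \<open>Q\<close> the LP relaxation in the variables \<open>(x, y, z)\<close>, and
  \<open>CARD('q)\<close> the number of binary variables.
\<close>

definition mip_formulation ::
    "'a::real_vector set \<Rightarrow> ('a \<times> real \<times> (real ^ 'q)) set \<Rightarrow> ('a \<times> real) set \<Rightarrow> bool" where
  "mip_formulation V Q S \<longleftrightarrow>
     polyhedron_in (V \<times> UNIV \<times> UNIV) Q \<and>
     S = (\<lambda>(x, y, z). (x, y)) ` (Q \<inter> (UNIV \<times> UNIV \<times> binary))"

definition ideal_mip_formulation ::
    "'a::real_vector set \<Rightarrow> ('a \<times> real \<times> (real ^ 'q)) set \<Rightarrow> ('a \<times> real) set \<Rightarrow> bool" where
  "ideal_mip_formulation V Q S \<longleftrightarrow>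
     mip_formulation V Q S \<and>
     (\<forall>v. v extreme_point_of Q \<longrightarrow> v \<in> UNIV \<times> UNIV \<times> binary)"


section \<open>The formulation of the ReLU graph\<close>

definition mappings :: "nat \<Rightarrow> (nat \<Rightarrow> nat) \<Rightarrow> (nat \<Rightarrow> nat) set" where
  "mappings \<tau> p = (\<Pi>\<^sub>E i\<in>{1..\<tau>}. {1..p i})"

definition upper_bound ::
    "nat \<Rightarrow> (nat \<Rightarrow> nat) \<Rightarrow> (nat \<Rightarrow> nat \<Rightarrow> real) \<Rightarrow> real \<Rightarrow> (nat \<Rightarrow> nat) \<Rightarrow> point \<Rightarrow> real \<Rightarrow> real" where
  "upper_bound \<tau> p w b J x z =
     (\<Sum>i=1..\<tau>. w i (J i) * z +
        (\<Sum>j=J i + 1..p i. (w i j - w i (J i)) * Poly_Mapping.lookup x (i, j))) + b * z"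

definition relaxation ::
    "nat \<Rightarrow> (nat \<Rightarrow> nat) \<Rightarrow> (nat \<Rightarrow> nat \<Rightarrow> real) \<Rightarrow> real \<Rightarrow> (point \<times> real \<times> (real ^ 1)) set" where
  "relaxation \<tau> p w b =
     {(x, y, z). affine_fun \<tau> p w b x \<le> y \<and>
        (\<forall>J\<in>mappings \<tau> p. y \<le> upper_bound \<tau> p w b J x (z $ 1)) \<and>
        x \<in> simplex_product \<tau> p \<and> 0 \<le> y \<and> 0 \<le> z $ 1 \<and> z $ 1 \<le> 1}"

definition upper_halfspace ::
    "nat \<Rightarrow> (nat \<Rightarrow> nat) \<Rightarrow> (nat \<Rightarrow> nat \<Rightarrow> real) \<Rightarrow> real \<Rightarrow> (nat \<Rightarrow> nat) \<Rightarrow>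
      (point \<times> real \<times> (real ^ 1)) set" where
  "upper_halfspace \<tau> p w b J =
     {(x, y, z). x \<in> coord_space \<tau> p \<and> y \<le> upper_bound \<tau> p w b J x (z $ 1)}"

text \<open>
  Different mappings may define the same halfspace (equal weights), so redundancy is a property of a
  member of the set of halfspaces. The intersection with \<open>V\<close> matters when a single one is removed
  from a singleton.
\<close>

definition redundant_in :: "'a set \<Rightarrow> 'a set set \<Rightarrow> 'a set \<Rightarrow> bool" where
  "redundant_in V \<H> H \<longleftrightarrow> \<not> (V \<inter> \<Inter>\<H> \<subset> V \<inter> \<Inter>(\<H> - {H}))"

definition most_violated ::
    "nat \<Rightarrow> (nat \<Rightarrow> nat) \<Rightarrow> (nat \<Rightarrow> nat \<Rightarrow> real) \<Rightarrow> real \<Rightarrow> point \<Rightarrow> real \<Rightarrow> real \<Rightarrow>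
      (nat \<Rightarrow> nat) \<Rightarrow> bool" where
  "most_violated \<tau> p w b x y z J \<longleftrightarrow>
     J \<in> mappings \<tau> p \<and>
     0 < y - upper_bound \<tau> p w b J x z \<and>
     (\<forall>J'\<in>mappings \<tau> p. y - upper_bound \<tau> p w b J' x z \<le> y - upper_bound \<tau> p w b J x z)"


section \<open>A real random access machine\<close>

text \<open>
  Programs are syntax, so they cannot depend on the instance. Memory consists of arrays of naturals
  and arrays of reals, both named by constants of the program and indexed by computed naturals.
  There are no multiplications on naturals and no roundings from reals to naturals, so unit cost per
  operation is the usual measure.
\<close>

record memory =
  nats :: "nat \<Rightarrow> nat \<Rightarrow> nat"
  reals :: "nat \<Rightarrow> nat \<Rightarrow> real"

datatype nexp =
    NConst nat
  | NRead nat nexp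
  | NAdd nexp nexp
  | NSub nexp nexp

datatype rexp =
    RConst rat
  | RRead nat nexp
  | RAdd rexp rexp
  | RSub rexp rexp
  | RMul rexp rexp
  | RDiv rexp rexp

datatype bexp =
    NLess nexp nexp
  | RLess rexp rexp
  | BNot bexp
  | BAnd bexp bexp

primrec nval :: "nexp \<Rightarrow> memory \<Rightarrow> nat" where
  "nval (NConst n) s = n"
| "nval (NRead a e) s = nats s a (nval e s)"
| "nval (NAdd e f) s = nval e s + nval f s"
| "nval (NSub e f) s = nval e s - nval f s"

primrec rval :: "rexp \<Rightarrow> memory \<Rightarrow> real" where
  "rval (RConst q) s = of_rat q"
| "rval (RRead a e) s = reals s a (nval e s)"
| "rval (RAdd e f) s = rval e s + rval f s"
| "rval (RSub e f) s = rval e s - rval f s"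
| "rval (RMul e f) s = rval e s * rval f s"
| "rval (RDiv e f) s = rval e s / rval f s"

primrec bval :: "bexp \<Rightarrow> memory \<Rightarrow> bool" where
  "bval (NLess e f) s \<longleftrightarrow> nval e s < nval f s"
| "bval (RLess e f) s \<longleftrightarrow> rval e s < rval f s"
| "bval (BNot c) s \<longleftrightarrow> \<not> bval c s"
| "bval (BAnd c d) s \<longleftrightarrow> bval c s \<and> bval d s"

primrec ncost :: "nexp \<Rightarrow> nat" where
  "ncost (NConst n) = 1"
| "ncost (NRead a e) = ncost e + 1"
| "ncost (NAdd e f) = ncost e + ncost f + 1"
| "ncost (NSub e f) = ncost e + ncost f + 1"

primrec rcost :: "rexp \<Rightarrow> nat" where
  "rcost (RConst q) = 1"
| "rcost (RRead a e) = ncost e + 1"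
| "rcost (RAdd e f) = rcost e + rcost f + 1"
| "rcost (RSub e f) = rcost e + rcost f + 1"
| "rcost (RMul e f) = rcost e + rcost f + 1"
| "rcost (RDiv e f) = rcost e + rcost f + 1"

primrec bcost :: "bexp \<Rightarrow> nat" where
  "bcost (NLess e f) = ncost e + ncost f + 1"
| "bcost (RLess e f) = rcost e + rcost f + 1"
| "bcost (BNot c) = bcost c + 1"
| "bcost (BAnd c d) = bcost c + bcost d + 1"

datatype com =
    Skip
  | NAssign nat nexp nexp
  | RAssign nat nexp rexp
  | Seq com com
  | Cond bexp com com
  | While bexp com

definition store :: "(nat \<Rightarrow> nat \<Rightarrow> 'a) \<Rightarrow> nat \<Rightarrow> nat \<Rightarrow> 'a \<Rightarrow> nat \<Rightarrow> nat \<Rightarrow> 'a" where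
  "store m a k v = m(a := (m a)(k := v))"

text \<open>\<open>exec c s t s'\<close>: started in \<open>s\<close>, the program \<open>c\<close> halts in \<open>s'\<close> after \<open>t\<close> operations.\<close>

inductive exec :: "com \<Rightarrow> memory \<Rightarrow> nat \<Rightarrow> memory \<Rightarrow> bool" where
  Skip: "exec Skip s 1 s"
| NAssign: "exec (NAssign a k e) s (ncost k + ncost e + 1)
    (s\<lparr>nats := store (nats s) a (nval k s) (nval e s)\<rparr>)"
| RAssign: "exec (RAssign a k e) s (ncost k + rcost e + 1)
    (s\<lparr>reals := store (reals s) a (nval k s) (rval e s)\<rparr>)"
| Seq: "exec c s t s' \<Longrightarrow> exec d s' t' s'' \<Longrightarrow> exec (Seq c d) s (t + t') s''"
| CondTrue: "bval g s \<Longrightarrow> exec c s t s' \<Longrightarrow> exec (Cond g c d) s (bcost g + t) s'"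
| CondFalse: "\<not> bval g s \<Longrightarrow> exec d s t s' \<Longrightarrow> exec (Cond g c d) s (bcost g + t) s'"
| WhileTrue: "bval g s \<Longrightarrow> exec c s t s' \<Longrightarrow> exec (While g c) s' t' s'' \<Longrightarrow>
    exec (While g c) s (bcost g + t + t') s''"
| WhileFalse: "\<not> bval g s \<Longrightarrow> exec (While g c) s (bcost g) s"

inductive_cases exec_SkipE: "exec Skip s t s'"
inductive_cases exec_NAssignE: "exec (NAssign a k e) s t s'"
inductive_cases exec_RAssignE: "exec (RAssign a k e) s t s'"
inductive_cases exec_SeqE: "exec (Seq c d) s t s'"
inductive_cases exec_CondE: "exec (Cond g c d) s t s'"
inductive_cases exec_WhileE: "exec (While g c) s t s'"

lemma exec_deterministic:
  "exec c s t s' \<Longrightarrow> exec c s u s'' \<Longrightarrow> u = t \<and> s'' = s'"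
proof (induction arbitrary: u s'' rule: exec.induct)
  case (Skip s)
  then show ?case by (rule exec_SkipE) simp
next
  case (NAssign a k e s)
  then show ?case by (rule exec_NAssignE) simp
next
  case (RAssign a k e s)
  then show ?case by (rule exec_RAssignE) simp
next
  case (Seq c s t s1 d t' s2)
  from Seq.prems obtain v v' r where "exec c s v r" "exec d r v' s''" "u = v + v'"
    by (rule exec_SeqE)
  then show ?case using Seq.IH by metis
next
  case (CondTrue g s c t s1 d)
  from CondTrue.prems obtain v where "exec c s v s''" "u = bcost g + v"
    by (rule exec_CondE) (use CondTrue.hyps in auto)
  then show ?case using CondTrue.IH by metis
next
  case (CondFalse g s d t s1 c)
  from CondFalse.prems obtain v where "exec d s v s''" "u = bcost g + v"
    by (rule exec_CondE) (use CondFalse.hyps in auto)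
  then show ?case using CondFalse.IH by metis
next
  case (WhileTrue g s c t s1 t' s2)
  from WhileTrue.prems obtain v v' r
    where "exec c s v r" "exec (While g c) r v' s''" "u = bcost g + v + v'"
    by (rule exec_WhileE) (use WhileTrue.hyps in auto)
  then show ?case using WhileTrue.IH by metis
next
  case (WhileFalse g s c)
  from WhileFalse.prems show ?case
    by (rule exec_WhileE) (use WhileFalse.hyps in auto)
qed


section \<open>Input and output of a separation program\<close>

text \<open>
  The rows of \<open>w\<close> and \<open>x\<close> are stored one after another: the entry \<open>(i, j)\<close> is in cell
  \<open>cell p i j\<close>. Memory outside the input is arbitrary.
\<close>

definition cell :: "(nat \<Rightarrow> nat) \<Rightarrow> nat \<Rightarrow> nat \<Rightarrow> nat" where
  "cell p i j = (\<Sum>k=1..<i. p k) + j"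

definition holds_input ::
    "memory \<Rightarrow> nat \<Rightarrow> (nat \<Rightarrow> nat) \<Rightarrow> (nat \<Rightarrow> nat \<Rightarrow> real) \<Rightarrow> real \<Rightarrow> point \<Rightarrow> real \<Rightarrow> real \<Rightarrow> bool" where
  "holds_input s \<tau> p w b x y z \<longleftrightarrow>
     nats s 0 0 = \<tau> \<and>
     (\<forall>i\<in>{1..\<tau>}. nats s 1 i = p i) \<and>
     reals s 0 0 = b \<and> reals s 0 1 = y \<and> reals s 0 2 = z \<and>
     (\<forall>(i, j)\<in>idx \<tau> p. reals s 1 (cell p i j) = w i j) \<and>
     (\<forall>(i, j)\<in>idx \<tau> p. reals s 2 (cell p i j) = Poly_Mapping.lookup x (i, j))"

text \<open>
  Cell 0 of the output array is a flag telling whether a violated constraint exists; if so, cells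
  \<open>1, \<dots>, \<tau>\<close> hold a mapping.
\<close>

definition holds_output ::
    "memory \<Rightarrow> nat \<Rightarrow> (nat \<Rightarrow> nat) \<Rightarrow> (nat \<Rightarrow> nat \<Rightarrow> real) \<Rightarrow> real \<Rightarrow> point \<Rightarrow> real \<Rightarrow> real \<Rightarrow> bool" where
  "holds_output s \<tau> p w b x y z \<longleftrightarrow>
     (if \<exists>J\<in>mappings \<tau> p. upper_bound \<tau> p w b J x z < y
      then nats s 2 0 = 1 \<and> most_violated \<tau> p w b x y z (restrict (nats s 2) {1..\<tau>})
      else nats s 2 0 = 0)"

end

theory Submission
  imports Defs
begin

text \<open>
  For fixed \<open>x \<in> D\<close> and \<open>z \<in> [0, 1]\<close>, the minimum over \<open>J\<close> of the right-hand side of (b) separates over the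
  simplices and is the value of the continuous knapsack problem of maximising \<open>w \<bullet> u + b z\<close> over
  \<open>0 \<le> u \<le> x\<close> where every row of \<open>u\<close> sums to \<open>z\<close>. If \<open>0 < z < 1\<close>, the value at \<open>u = z x\<close> is at most
  \<open>y\<close>, so a mixture \<open>v\<close> of \<open>z x\<close> and the optimal \<open>u\<close> attains \<open>y\<close> exactly, and \<open>(x, y, z)\<close> is the
  convex combination of \<open>((x - v) / (1 - z), 0, 0)\<close> and \<open>(v / z, y / z, 1)\<close>, both in the relaxation.
  For non-redundancy of the constraint of \<open>J\<close> take \<open>z = 1\<close> and \<open>x\<close> with \<open>x\<^bsub>i,J(i)\<^esub> = 2\<close> and all other
  coordinates 0: moving \<open>J(i)\<close> to \<open>k\<close> raises the right-hand side by \<open>\<bar>w\<^bsub>i,k\<^esub> - w\<^bsub>i,J(i)\<^esub>\<bar>\<close>. For separation,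
  the right-hand side is minimised row by row with suffix sums.
\<close>

section \<open>One simplex\<close>

text \<open>The share of one simplex in the right-hand side of (b) when \<open>J\<close> picks
  \<open>j\<close> there. Weights and coordinates are plain functions, so all minimisation over
  \<open>J\<close> happens one row at a time.\<close>

definition row_value :: "(nat \<Rightarrow> real) \<Rightarrow> (nat \<Rightarrow> real) \<Rightarrow> real \<Rightarrow> nat \<Rightarrow> nat \<Rightarrow> real" where
  "row_value w x z n j = w j * z + (\<Sum>l=j+1..n. (w l - w j) * x l)"

lemma upper_bound_eq_row_values:
  "upper_bound \<tau> p w b J x z =
     (\<Sum>i=1..\<tau>. row_value (w i) (\<lambda>j. Poly_Mapping.lookup x (i, j)) z (p i) (J i)) + b * z"
  by (simp add: upper_bound_def row_value_def)

text \<open>Knapsack reading: the entries after \<open>j\<close> are taken in full, and the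
  remaining mass is charged at the weight \<open>w j\<close>. The two suffix sums are also what the
  separation program maintains.\<close>

lemma row_value_eq_suffix_sums:
  "row_value w x z n j = w j * (z - (\<Sum>l=j+1..n. x l)) + (\<Sum>l=j+1..n. w l * x l)"
  by (simp add: row_value_def sum_subtractf left_diff_distrib right_diff_distrib sum_distrib_left)

lemma sum_Icc_split:
  fixes f :: "nat \<Rightarrow> real"
  assumes "j \<le> n"
  shows "sum f {1..n} = sum f {1..j} + sum f {j+1..n}"
  using sum.ub_add_nat[of 1 j f "n - j"] assms by simp

section \<open>Values of a row at z = 0 and z = 1\<close>

lemma row_value_last_at_0 [simp]: "row_value w x 0 n n = 0"
  by (simp add: row_value_def)

lemma row_value_at_0_nonneg:
  assumes "mono_on {1..n} w" "\<And>l. l \<in> {1..n} \<Longrightarrow> 0 \<le> x l" "j \<in> {1..n}"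
  shows "0 \<le> row_value w x 0 n j"
  unfolding row_value_def
  using assms by (auto intro!: sum_nonneg mult_nonneg_nonneg simp: mono_on_def)

text \<open>For index 1 the mass left over by the suffix is exactly \<open>x 1\<close>, so nothing
  is overcharged.\<close>

lemma row_value_first_at_1:
  assumes "1 \<le> n" "(\<Sum>l=1..n. x l) = 1"
  shows "row_value w x 1 n 1 = (\<Sum>l=1..n. w l * x l)"
proof -
  have "x 1 = 1 - (\<Sum>l=1+1..n. x l)"
    using sum_Icc_split[of 1 n x] assms by simp
  then show ?thesis
    using sum_Icc_split[of 1 n "\<lambda>l. w l * x l"] assms by (simp add: row_value_eq_suffix_sums)
qed

text \<open>The first \<open>j\<close> entries are all charged at \<open>w j\<close>, the largest
  weight among them.\<close>

lemma row_value_at_1_ge: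
  assumes "mono_on {1..n} w" "\<And>l. l \<in> {1..n} \<Longrightarrow> 0 \<le> x l" "(\<Sum>l=1..n. x l) = 1" "j \<in> {1..n}"
  shows "(\<Sum>l=1..n. w l * x l) \<le> row_value w x 1 n j"
proof -
  have j: "j \<le> n" using assms by simp
  have "(\<Sum>l=1..j. w l * x l) \<le> (\<Sum>l=1..j. w j * x l)"
    using assms by (intro sum_mono mult_right_mono) (auto simp: mono_on_def)
  also have "\<dots> = w j * (1 - (\<Sum>l=j+1..n. x l))"
    using sum_Icc_split[OF j, of x] assms by (simp flip: sum_distrib_left)
  finally show ?thesis
    using sum_Icc_split[OF j, of "\<lambda>l. w l * x l"] by (simp add: row_value_eq_suffix_sums)
qed

text \<open>
  The continuous knapsack problem of maximising \<open>w \<bullet> u\<close> over \<open>0 \<le> u \<le> x\<close> with total mass \<open>z\<close>: filling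
  up from the largest weight, the last index that receives mass gives the value of the row.
\<close>

lemma row_value_attained:
  assumes x: "\<And>l. l \<in> {1..n} \<Longrightarrow> 0 \<le> x l" and sum1: "(\<Sum>l=1..n. x l) = 1"
    and z: "0 \<le> z" "z \<le> 1"
  obtains j u where "j \<in> {1..n}" "\<And>l. l \<in> {1..n} \<Longrightarrow> 0 \<le> u l \<and> u l \<le> x l"
    "(\<Sum>l=1..n. u l) = z" "(\<Sum>l=1..n. w l * u l) = row_value w x z n j"
proof -
  have n: "1 \<le> n" using sum1 by (cases n) auto
  \<comment> \<open>\<open>P j\<close> says that all entries strictly after \<open>j\<close> fit
    into the mass \<open>z\<close>; the least such \<open>j\<close> is where the greedy filling
    stops.\<close>
  define P where "P j \<longleftrightarrow> 1 \<le> j \<and> (\<Sum>l=j+1..n. x l) \<le> z" for j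
  define j where "j = (LEAST j. P j)"
  have "P n" using n z by (simp add: P_def)
  then have Pj: "P j" and jn: "j \<le> n"
    unfolding j_def by (rule LeastI, rule Least_le)
  define S where "S = (\<Sum>l=j+1..n. x l)"
  have j1: "1 \<le> j" and Sz: "S \<le> z" using Pj by (auto simp: P_def S_def)
  have rest: "sum f {j..n} = f j + sum f {j+1..n}" for f :: "nat \<Rightarrow> real"
    using jn by (simp add: sum.atLeast_Suc_atMost)
  have zS: "z \<le> x j + S"
  proof (cases "j = 1")
    case True
    then show ?thesis using sum1 z rest[of x] by (simp add: S_def)
  next
    case False
    \<comment> \<open>By minimality entry \<open>j\<close> does not fit in full any more, so it can
      absorb the remaining mass \<open>z - S\<close>.\<close>
    then have "\<not> P (j - 1)" using not_less_Least[of "j - 1" P] j1 by (simp add: j_def)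
    then show ?thesis using False j1 rest[of x] by (auto simp: P_def S_def)
  qed
  define u where "u l = (if l < j then 0 else if l = j then z - S else x l)" for l
  \<comment> \<open>Stated for arbitrary coefficients: \<open>c = 1\<close> gives the total mass and
    \<open>c = w\<close> the objective value.\<close>
  have sum_u: "(\<Sum>l=1..n. c l * u l) = c j * (z - S) + (\<Sum>l=j+1..n. c l * x l)"
    for c :: "nat \<Rightarrow> real"
  proof -
    have "(\<Sum>l=1..n. c l * u l) = (\<Sum>l=j..n. c l * u l)"
      using j1 by (intro sum.mono_neutral_right) (auto simp: u_def)
    also have "\<dots> = c j * (z - S) + (\<Sum>l=j+1..n. c l * u l)"
      by (subst rest) (simp add: u_def)
    also have "(\<Sum>l=j+1..n. c l * u l) = (\<Sum>l=j+1..n. c l * x l)"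
      by (rule sum.cong) (auto simp: u_def)
    finally show ?thesis .
  qed
  show ?thesis
  proof
    show "j \<in> {1..n}" using j1 jn by simp
    show "0 \<le> u l \<and> u l \<le> x l" if "l \<in> {1..n}" for l
      using that x[OF that] Sz zS by (auto simp: u_def)
    show "(\<Sum>l=1..n. u l) = z"
      using sum_u[of "\<lambda>_. 1"] by (simp add: S_def)
    show "(\<Sum>l=1..n. w l * u l) = row_value w x z n j"
      using sum_u[of w] by (simp add: row_value_eq_suffix_sums S_def)
  qed
qed

text \<open>For \<open>k < j\<close> the spike of height 2 adds \<open>2 * (w j - w k)\<close>,
  which reflects \<open>w k\<close> about \<open>w j\<close>; for \<open>k \<ge> j\<close> it lies
  outside the sum. Either way sorting turns the result into a distance from
  \<open>w j\<close>.\<close>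

lemma row_value_spike:
  assumes "mono_on {1..n} w" "j \<in> {1..n}" "k \<in> {1..n}"
  shows "row_value w (\<lambda>l. if l = j then 2 else 0) 1 n k = w j + \<bar>w k - w j\<bar>"
proof -
  have "(\<Sum>l=k+1..n. (w l - w k) * (if l = j then 2 else 0)) =
        (\<Sum>l=k+1..n. if l = j then 2 * (w j - w k) else 0)"
    by (rule sum.cong) auto
  also have "\<dots> = (if k < j then 2 * (w j - w k) else 0)"
    using assms by auto
  finally have "row_value w (\<lambda>l. if l = j then 2 else 0) 1 n k =
      w k + (if k < j then 2 * (w j - w k) else 0)"
    by (simp add: row_value_def)
  moreover have "k < j \<Longrightarrow> w k \<le> w j" "\<not> k < j \<Longrightarrow> w j \<le> w k"
    using mono_onD[OF assms(1)] assms by auto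
  ultimately show ?thesis by auto
qed

text \<open>Sorted weights are constant between two indices of equal weight, so the terms by which
  the two sums differ vanish.\<close>

lemma row_value_eq_if_weights_eq:
  assumes "mono_on {1..n} w" "j \<in> {1..n}" "k \<in> {1..n}" "w j = w k"
  shows "row_value w x z n j = row_value w x z n k"
proof -
  have *: "row_value w x z n j = row_value w x z n k"
    if "j \<le> k" "j \<in> {1..n}" "k \<in> {1..n}" "w j = w k" for j k
  proof -
    have neutral: "(w l - w k) * x l = 0" if "l \<in> {j+1..n} - {k+1..n}" for l
    proof -
      have "w j \<le> w l" "w l \<le> w k"
        using mono_onD[OF assms(1)] that \<open>j \<in> {1..n}\<close> \<open>k \<in> {1..n}\<close> by auto
      then show ?thesis using \<open>w j = w k\<close> by simp
    qed
    have "(\<Sum>l=k+1..n. (w l - w k) * x l) = (\<Sum>l=j+1..n. (w l - w k) * x l)"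
      using \<open>j \<le> k\<close> by (intro sum.mono_neutral_left ballI neutral) auto
    then show ?thesis using that by (simp add: row_value_def)
  qed
  show ?thesis
    using * assms(2-4) by (metis nat_le_linear)
qed

section \<open>The space of points\<close>

lemma lookup_scaleR [simp]:
  "Poly_Mapping.lookup (c *\<^sub>R x) k = c * Poly_Mapping.lookup x k" for x :: "'k \<Rightarrow>\<^sub>0 real"
proof -
  have "finite {i. c * Poly_Mapping.lookup x i \<noteq> 0}"
    by (rule finite_subset[OF _ finite_keys[of x]]) (auto simp: in_keys_iff)
  then show ?thesis by (simp add: scaleR_poly_mapping_def)
qed

lemma linear_lookup: "linear (\<lambda>x :: 'k \<Rightarrow>\<^sub>0 real. Poly_Mapping.lookup x k)"
  by (rule linearI) (simp_all add: lookup_add)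

lemma finite_idx: "finite (idx \<tau> p)"
  by (simp add: idx_def)

lemma coord_space_iff: "x \<in> coord_space \<tau> p \<longleftrightarrow> (\<forall>k. k \<notin> idx \<tau> p \<longrightarrow> Poly_Mapping.lookup x k = 0)"
  by (auto simp: coord_space_def in_keys_iff)

text \<open>Extending by 0 outside the finite index set keeps the support finite. This builds the
  knapsack solution and the point that separates one halfspace from the others.\<close>

lemma point_with_coords:
  obtains x where "x \<in> coord_space \<tau> p"
    "\<And>i j. i \<in> {1..\<tau>} \<Longrightarrow> j \<in> {1..p i} \<Longrightarrow> Poly_Mapping.lookup x (i, j) = f i j"
proof -
  define g where "g k = (if k \<in> idx \<tau> p then f (fst k) (snd k) else (0::real))" for k
  have "finite {k. g k \<noteq> 0}"
    by (rule finite_subset[OF _ finite_idx[of \<tau> p]]) (auto simp: g_def)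
  then have "Poly_Mapping.lookup (Abs_poly_mapping g) = g" by simp
  then show ?thesis
    by (intro that[of "Abs_poly_mapping g"]) (auto simp: coord_space_iff g_def idx_def)
qed

lemma finite_mappings: "finite (mappings \<tau> p)"
  by (simp add: mappings_def finite_PiE)

lemma mappings_mem: "J \<in> mappings \<tau> p \<Longrightarrow> i \<in> {1..\<tau>} \<Longrightarrow> J i \<in> {1..p i}"
  by (auto simp: mappings_def)

lemma simplex_product_nonneg:
  "x \<in> simplex_product \<tau> p \<Longrightarrow> i \<in> {1..\<tau>} \<Longrightarrow> j \<in> {1..p i} \<Longrightarrow> 0 \<le> Poly_Mapping.lookup x (i, j)"
  by (auto simp: simplex_product_def)

lemma simplex_product_sum:
  "x \<in> simplex_product \<tau> p \<Longrightarrow> i \<in> {1..\<tau>} \<Longrightarrow> (\<Sum>j=1..p i. Poly_Mapping.lookup x (i, j)) = 1"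
  by (auto simp: simplex_product_def)

lemma relu_instance_mono: "relu_instance \<tau> p w b \<Longrightarrow> i \<in> {1..\<tau>} \<Longrightarrow> mono_on {1..p i} (w i)"
  by (auto simp: relu_instance_def)

text \<open>The domain is nonempty, and an empty row would sum to 0 instead of 1.\<close>

lemma relu_instance_p_pos:
  assumes "relu_instance \<tau> p w b" "i \<in> {1..\<tau>}"
  shows "1 \<le> p i"
proof (rule ccontr)
  assume "\<not> 1 \<le> p i"
  moreover obtain x where "x \<in> simplex_product \<tau> p"
    using assms by (auto simp: relu_instance_def)
  ultimately show False using simplex_product_sum[of x \<tau> p i] assms(2) by (simp add: not_le)
qed

section \<open>Polyhedra\<close>

lemma polyhedron_in_halfspace:
  fixes \<phi> :: "'a::real_vector \<Rightarrow> real"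
  shows "linear \<phi> \<Longrightarrow> polyhedron_in V {v \<in> V. \<phi> v \<le> c}"
  unfolding polyhedron_in_def by (rule exI[of _ "{(\<phi>, c)}"]) auto

lemma polyhedron_in_self: "polyhedron_in V V"
  unfolding polyhedron_in_def by (rule exI[of _ "{}"]) auto

lemma polyhedron_in_Int:
  fixes Q R V :: "'a::real_vector set"
  assumes "polyhedron_in V Q" "polyhedron_in V R"
  shows "polyhedron_in V (Q \<inter> R)"
proof -
  obtain F :: "(('a \<Rightarrow> real) \<times> real) set" where F: "finite F" "\<forall>(\<phi>, c)\<in>F. linear \<phi>"
    "Q = {v \<in> V. \<forall>(\<phi>, c)\<in>F. \<phi> v \<le> c}"
    using assms(1) unfolding polyhedron_in_def by blast
  obtain G :: "(('a \<Rightarrow> real) \<times> real) set" where G: "finite G" "\<forall>(\<phi>, c)\<in>G. linear \<phi>"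
    "R = {v \<in> V. \<forall>(\<phi>, c)\<in>G. \<phi> v \<le> c}"
    using assms(2) unfolding polyhedron_in_def by blast
  have "Q \<inter> R = {v \<in> V. \<forall>(\<phi>, c)\<in>F \<union> G. \<phi> v \<le> c}"
    unfolding F(3) G(3) by blast
  moreover have "finite (F \<union> G)" "\<forall>(\<phi>, c)\<in>F \<union> G. linear \<phi>"
    using F G by blast+
  ultimately show ?thesis unfolding polyhedron_in_def by blast
qed

lemma polyhedron_in_Ball:
  assumes "finite I" "\<And>i. i \<in> I \<Longrightarrow> polyhedron_in V {v \<in> V. P i v}"
  shows "polyhedron_in V {v \<in> V. \<forall>i\<in>I. P i v}"
  using assms
proof (induction I rule: finite_induct)
  case empty
  then show ?case by (simp add: polyhedron_in_self)
next
  case (insert i I)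
  have "{v \<in> V. \<forall>k\<in>insert i I. P k v} = {v \<in> V. P i v} \<inter> {v \<in> V. \<forall>k\<in>I. P k v}"
    by auto
  then show ?case using insert by (auto intro: polyhedron_in_Int)
qed

lemma polyhedron_in_conj:
  assumes "polyhedron_in V {v \<in> V. P v}" "polyhedron_in V {v \<in> V. R v}"
  shows "polyhedron_in V {v \<in> V. P v \<and> R v}"
proof -
  have "{v \<in> V. P v \<and> R v} = {v \<in> V. P v} \<inter> {v \<in> V. R v}" by auto
  then show ?thesis using polyhedron_in_Int[OF assms] by simp
qed

lemma polyhedron_in_le:
  fixes \<phi> \<psi> :: "'a::real_vector \<Rightarrow> real"
  assumes "linear \<phi>" "linear \<psi>"
  shows "polyhedron_in V {v \<in> V. \<phi> v + c \<le> \<psi> v + d}"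
proof -
  have "{v \<in> V. \<phi> v + c \<le> \<psi> v + d} = {v \<in> V. \<phi> v - \<psi> v \<le> d - c}" by auto
  then show ?thesis
    using polyhedron_in_halfspace[OF linear_compose_sub[OF assms], of V "d - c"] by simp
qed

lemma polyhedron_in_eq:
  fixes \<phi> :: "'a::real_vector \<Rightarrow> real"
  assumes "linear \<phi>"
  shows "polyhedron_in V {v \<in> V. \<phi> v = c}"
proof -
  have "{v \<in> V. \<phi> v = c} = {v \<in> V. \<phi> v + 0 \<le> 0 + c \<and> 0 + c \<le> \<phi> v + 0}" by auto
  then show ?thesis
    using polyhedron_in_conj[OF polyhedron_in_le[OF assms linear_zero, of V 0 c]
        polyhedron_in_le[OF linear_zero assms, of V c 0]] by simp
qed

section \<open>The relaxation\<close>

lemma linear_coord_x: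
  "linear (\<lambda>v :: point \<times> real \<times> (real ^ 1). Poly_Mapping.lookup (fst v) k)"
  using linear_compose[OF linear_fst linear_lookup] by (simp add: o_def)

lemma linear_coord_y: "linear (\<lambda>v :: point \<times> real \<times> (real ^ 1). fst (snd v))"
  by (rule linearI) simp_all

lemma linear_coord_z: "linear (\<lambda>v :: point \<times> real \<times> (real ^ 1). snd (snd v) $ 1)"
  by (rule linearI) simp_all

lemma linear_scale: "linear f \<Longrightarrow> linear (\<lambda>v. c * f v :: real)"
  using linear_compose_scale_right[of f c] by simp

lemmas linear_intros = linear_coord_x linear_coord_y linear_coord_z linear_scale linear_compose_add
  linear_compose_sum linear_zero

lemma polyhedron_relaxation:
  "polyhedron_in (coord_space \<tau> p \<times> UNIV \<times> UNIV) (relaxation \<tau> p w b)"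
    (is "polyhedron_in ?V _")
proof -
  let ?x = "\<lambda>(v :: point \<times> real \<times> (real ^ 1)) k. Poly_Mapping.lookup (fst v) k"
  let ?y = "\<lambda>v :: point \<times> real \<times> (real ^ 1). fst (snd v)"
  let ?z = "\<lambda>v :: point \<times> real \<times> (real ^ 1). snd (snd v) $ 1"
  \<comment> \<open>The padding with 0 brings every inequality into the shape of
    \<open>polyhedron_in_le\<close>, so that the closure rules apply by structure alone.\<close>
  have *: "relaxation \<tau> p w b = {v \<in> ?V.
      (\<Sum>i=1..\<tau>. \<Sum>j=1..p i. w i j * ?x v (i, j)) + b \<le> ?y v + 0 \<and>
      (\<forall>J\<in>mappings \<tau> p. ?y v + 0 \<le>
        ((\<Sum>i=1..\<tau>. w i (J i) * ?z v +
           (\<Sum>j=J i + 1..p i. (w i j - w i (J i)) * ?x v (i, j))) + b * ?z v) + 0) \<and>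
      (\<forall>i\<in>{1..\<tau>}. (\<forall>j\<in>{1..p i}. 0 + 0 \<le> ?x v (i, j) + 0) \<and> (\<Sum>j=1..p i. ?x v (i, j)) = 1) \<and>
      0 + 0 \<le> ?y v + 0 \<and> 0 + 0 \<le> ?z v + 0 \<and> ?z v + 0 \<le> 0 + 1}"
    unfolding relaxation_def simplex_product_def affine_fun_def upper_bound_def add_0_left add_0_right
    by (rule set_eqI) (simp only: mem_Collect_eq case_prod_beta mem_Times_iff UNIV_I simp_thms, blast)
  show ?thesis
    unfolding *
    by (intro polyhedron_in_conj polyhedron_in_Ball polyhedron_in_le polyhedron_in_eq linear_intros
        finite_mappings finite_atLeastAtMost ballI)
qed

section \<open>The family (b) and the relaxation at z = 0 and z = 1\<close>

lemma affine_le_upper_bound_at_1: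
  assumes "relu_instance \<tau> p w b" "x \<in> simplex_product \<tau> p" "J \<in> mappings \<tau> p"
  shows "affine_fun \<tau> p w b x \<le> upper_bound \<tau> p w b J x 1"
  unfolding upper_bound_eq_row_values affine_fun_def
  using relu_instance_mono[OF assms(1)] simplex_product_nonneg[OF assms(2)]
    simplex_product_sum[OF assms(2)] mappings_mem[OF assms(3)]
  by (intro add_mono sum_mono row_value_at_1_ge) simp_all

lemma upper_bound_at_0_nonneg:
  assumes "relu_instance \<tau> p w b" "x \<in> simplex_product \<tau> p" "J \<in> mappings \<tau> p"
  shows "0 \<le> upper_bound \<tau> p w b J x 0"
  unfolding upper_bound_eq_row_values mult_zero_right add_0_right
  using relu_instance_mono[OF assms(1)] simplex_product_nonneg[OF assms(2)]
    mappings_mem[OF assms(3)]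
  by (intro sum_nonneg row_value_at_0_nonneg) simp_all

text \<open>Choosing the first index in every row makes (b) meet (a) at z = 1.\<close>

lemma affine_eq_upper_bound_at_1:
  assumes "relu_instance \<tau> p w b" "x \<in> simplex_product \<tau> p"
  shows "\<exists>J\<in>mappings \<tau> p. upper_bound \<tau> p w b J x 1 = affine_fun \<tau> p w b x"
proof
  show "restrict (\<lambda>_. 1) {1..\<tau>} \<in> mappings \<tau> p"
    using relu_instance_p_pos[OF assms(1)] by (auto simp: mappings_def)
  show "upper_bound \<tau> p w b (restrict (\<lambda>_. 1) {1..\<tau>}) x 1 = affine_fun \<tau> p w b x"
    using assms(2) relu_instance_p_pos[OF assms(1)]
    unfolding upper_bound_eq_row_values affine_fun_def
    by (auto intro!: sum.cong row_value_first_at_1[unfolded One_nat_def] simp: simplex_product_def)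
qed

text \<open>With the last index in every row all inner sums are empty.\<close>

lemma upper_bound_at_0_eq_0:
  assumes "relu_instance \<tau> p w b"
  shows "\<exists>J\<in>mappings \<tau> p. upper_bound \<tau> p w b J x 0 = 0"
proof
  show "restrict p {1..\<tau>} \<in> mappings \<tau> p"
    using relu_instance_p_pos[OF assms(1)] by (auto simp: mappings_def)
  show "upper_bound \<tau> p w b (restrict p {1..\<tau>}) x 0 = 0"
    by (simp add: upper_bound_eq_row_values)
qed

lemma relaxation_iff:
  "(x, y, z) \<in> relaxation \<tau> p w b \<longleftrightarrow> affine_fun \<tau> p w b x \<le> y \<and>
     (\<forall>J\<in>mappings \<tau> p. y \<le> upper_bound \<tau> p w b J x (z $ 1)) \<and>
     x \<in> simplex_product \<tau> p \<and> 0 \<le> y \<and> 0 \<le> z $ 1 \<and> z $ 1 \<le> 1"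
  by (simp add: relaxation_def)

text \<open>(a) and the constraint of the first indices squeeze \<open>y\<close> to the affine
  value; every other member of (b) is weaker there.\<close>

lemma relaxation_at_1_iff:
  assumes "relu_instance \<tau> p w b" "z $ 1 = 1"
  shows "(x, y, z) \<in> relaxation \<tau> p w b \<longleftrightarrow>
    x \<in> simplex_product \<tau> p \<and> y = affine_fun \<tau> p w b x \<and> 0 \<le> affine_fun \<tau> p w b x"
    (is "?l \<longleftrightarrow> ?r")
proof
  assume ?l
  then have "affine_fun \<tau> p w b x \<le> y" "x \<in> simplex_product \<tau> p" "0 \<le> y"
    and le: "\<And>J. J \<in> mappings \<tau> p \<Longrightarrow> y \<le> upper_bound \<tau> p w b J x 1"
    using assms(2) by (simp_all add: relaxation_iff)
  moreover obtain J where "J \<in> mappings \<tau> p" "upper_bound \<tau> p w b J x 1 = affine_fun \<tau> p w b x"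
    using affine_eq_upper_bound_at_1[OF assms(1) \<open>x \<in> simplex_product \<tau> p\<close>] by blast
  ultimately show ?r using le[of J] by simp
next
  assume ?r
  then show ?l
    using affine_le_upper_bound_at_1[OF assms(1), of x] assms(2) by (simp add: relaxation_iff)
qed

text \<open>Nonnegativity and the constraint of the last indices squeeze \<open>y\<close> to 0, and
  then (a) makes the affine value nonpositive.\<close>

lemma relaxation_at_0_iff:
  assumes "relu_instance \<tau> p w b" "z $ 1 = 0"
  shows "(x, y, z) \<in> relaxation \<tau> p w b \<longleftrightarrow>
    x \<in> simplex_product \<tau> p \<and> y = 0 \<and> affine_fun \<tau> p w b x \<le> 0"
    (is "?l \<longleftrightarrow> ?r")
proof
  assume ?l
  then have "affine_fun \<tau> p w b x \<le> y" "x \<in> simplex_product \<tau> p" "0 \<le> y"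
    and le: "\<And>J. J \<in> mappings \<tau> p \<Longrightarrow> y \<le> upper_bound \<tau> p w b J x 0"
    using assms(2) by (simp_all add: relaxation_iff)
  moreover obtain J where "J \<in> mappings \<tau> p" "upper_bound \<tau> p w b J x 0 = 0"
    using upper_bound_at_0_eq_0[OF assms(1)] by blast
  ultimately show ?r using le[of J] by simp
next
  assume ?r
  then show ?l
    using upper_bound_at_0_nonneg[OF assms(1), of x] assms(2) by (simp add: relaxation_iff)
qed

lemma binary_1_iff: "z \<in> (binary :: (real ^ 1) set) \<longleftrightarrow> z $ 1 = 0 \<or> z $ 1 = 1"
  by (auto simp: binary_def forall_1)

lemma relu_graph_eq_projection:
  assumes "relu_instance \<tau> p w b"
  shows "relu_graph \<tau> p w b =
    (\<lambda>(x, y, z). (x, y)) ` (relaxation \<tau> p w b \<inter> (UNIV \<times> UNIV \<times> binary))"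
proof (intro set_eqI iffI)
  fix v assume "v \<in> relu_graph \<tau> p w b"
  then obtain x where v: "v = (x, max 0 (affine_fun \<tau> p w b x))" and x: "x \<in> simplex_product \<tau> p"
    by (auto simp: relu_graph_def)
  \<comment> \<open>On the hyperplane where the affine value is 0, both values of z describe the
    same point of the graph; 1 is chosen.\<close>
  define z :: "real ^ 1" where "z = (if 0 \<le> affine_fun \<tau> p w b x then 1 else 0)"
  have "(x, max 0 (affine_fun \<tau> p w b x), z) \<in> relaxation \<tau> p w b"
    using x relaxation_at_0_iff[OF assms, of z] relaxation_at_1_iff[OF assms, of z]
    by (cases "0 \<le> affine_fun \<tau> p w b x") (auto simp: z_def)
  moreover have "z \<in> binary" by (auto simp: binary_1_iff z_def)
  ultimately show "v \<in> (\<lambda>(x, y, z). (x, y)) ` (relaxation \<tau> p w b \<inter> (UNIV \<times> UNIV \<times> binary))"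
    unfolding v by (auto intro!: image_eqI)
next
  fix v assume "v \<in> (\<lambda>(x, y, z). (x, y)) ` (relaxation \<tau> p w b \<inter> (UNIV \<times> UNIV \<times> binary))"
  then obtain x y z where v: "v = (x, y)" and Q: "(x, y, z) \<in> relaxation \<tau> p w b"
    and z: "z \<in> binary" by auto
  from z consider "z $ 1 = 0" | "z $ 1 = 1" by (auto simp: binary_1_iff)
  then show "v \<in> relu_graph \<tau> p w b"
    using Q relaxation_at_0_iff[OF assms, of z x y] relaxation_at_1_iff[OF assms, of z x y]
    by cases (auto simp: v relu_graph_def)
qed

section \<open>Fractional points are not extreme\<close>

text \<open>The optimal knapsack solutions of the single rows are glued into one point
  \<open>u\<close>. Its rows have mass z instead of 1, hence the constant term
  \<open>b * z\<close>.\<close>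

lemma upper_bound_attained:
  assumes x: "x \<in> simplex_product \<tau> p" and z: "0 \<le> z" "z \<le> 1"
  obtains J u where "J \<in> mappings \<tau> p" "u \<in> coord_space \<tau> p"
    "\<And>i j. i \<in> {1..\<tau>} \<Longrightarrow> j \<in> {1..p i} \<Longrightarrow>
      0 \<le> Poly_Mapping.lookup u (i, j) \<and> Poly_Mapping.lookup u (i, j) \<le> Poly_Mapping.lookup x (i, j)"
    "\<And>i. i \<in> {1..\<tau>} \<Longrightarrow> (\<Sum>j=1..p i. Poly_Mapping.lookup u (i, j)) = z"
    "affine_fun \<tau> p w (b * z) u = upper_bound \<tau> p w b J x z"
proof -
  let ?row = "\<lambda>i j. Poly_Mapping.lookup x (i, j)"
  define P where "P i j r \<longleftrightarrow> j \<in> {1..p i} \<and> (\<forall>l\<in>{1..p i}. 0 \<le> r l \<and> r l \<le> ?row i l) \<and>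
      (\<Sum>l=1..p i. r l) = z \<and> (\<Sum>l=1..p i. w i l * r l) = row_value (w i) (?row i) z (p i) j"
    for i j r
  have "\<exists>j r. P i j r" if i: "i \<in> {1..\<tau>}" for i
  proof -
    obtain j r where "j \<in> {1..p i}" "\<And>l. l \<in> {1..p i} \<Longrightarrow> 0 \<le> r l \<and> r l \<le> ?row i l"
      "(\<Sum>l=1..p i. r l) = z" "(\<Sum>l=1..p i. w i l * r l) = row_value (w i) (?row i) z (p i) j"
      using row_value_attained[of "p i" "?row i" z "w i"] simplex_product_nonneg[OF x i]
        simplex_product_sum[OF x i] z by blast
    then show ?thesis unfolding P_def by blast
  qed
  then obtain J r where "\<And>i. i \<in> {1..\<tau>} \<Longrightarrow> P i (J i) (r i)"
    by metis
  then have Jr: "J i \<in> {1..p i}" "\<And>l. l \<in> {1..p i} \<Longrightarrow> 0 \<le> r i l \<and> r i l \<le> ?row i l"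
      "(\<Sum>l=1..p i. r i l) = z"
      "(\<Sum>l=1..p i. w i l * r i l) = row_value (w i) (?row i) z (p i) (J i)"
    if "i \<in> {1..\<tau>}" for i
    using that unfolding P_def by blast+
  obtain u where u: "u \<in> coord_space \<tau> p"
    "\<And>i j. i \<in> {1..\<tau>} \<Longrightarrow> j \<in> {1..p i} \<Longrightarrow> Poly_Mapping.lookup u (i, j) = r i j"
    using point_with_coords[of \<tau> p r] by blast
  show ?thesis
  proof
    show "restrict J {1..\<tau>} \<in> mappings \<tau> p" using Jr(1) by (simp add: mappings_def)
    show "u \<in> coord_space \<tau> p" by fact
    show "0 \<le> Poly_Mapping.lookup u (i, j) \<and> Poly_Mapping.lookup u (i, j) \<le> ?row i j"
      if "i \<in> {1..\<tau>}" "j \<in> {1..p i}" for i j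
      using Jr(2)[OF that] u(2)[OF that] by simp
    show "(\<Sum>j=1..p i. Poly_Mapping.lookup u (i, j)) = z" if "i \<in> {1..\<tau>}" for i
      using Jr(3)[OF that] u(2)[OF that] by simp
    show "affine_fun \<tau> p w (b * z) u = upper_bound \<tau> p w b (restrict J {1..\<tau>}) x z"
      unfolding affine_fun_def upper_bound_eq_row_values
      using Jr(4) u(2) by (intro arg_cong2[where f = "(+)"] sum.cong refl) simp
  qed
qed

lemma fractional_point_in_open_segment:
  assumes inst: "relu_instance \<tau> p w b" and Q: "(x, y, z) \<in> relaxation \<tau> p w b"
    and z: "0 < z $ 1" "z $ 1 < 1"
  obtains x0 x1 where "(x0, 0, 0) \<in> relaxation \<tau> p w b" "(x1, y / z $ 1, 1) \<in> relaxation \<tau> p w b"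
    "(x, y, z) \<in> open_segment (x0, 0, 0) (x1, y / z $ 1, 1)"
proof -
  define \<zeta> where "\<zeta> = z $ 1"
  have \<zeta>: "0 < \<zeta>" "\<zeta> < 1" using z by (simp_all add: \<zeta>_def)
  have x: "x \<in> simplex_product \<tau> p" and fy: "affine_fun \<tau> p w b x \<le> y" and y0: "0 \<le> y"
    and ub: "\<And>J. J \<in> mappings \<tau> p \<Longrightarrow> y \<le> upper_bound \<tau> p w b J x \<zeta>"
    using Q by (simp_all add: relaxation_iff \<zeta>_def)
  \<comment> \<open>The linear part, so that changing the constant of \<open>affine_fun\<close> only
    adds a number.\<close>
  define L where "L = affine_fun \<tau> p w 0"
  have lin: "linear L"
    unfolding L_def affine_fun_def add_0_right
    by (intro linear_compose_sum linear_scale linear_lookup ballI)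
  have f_eq: "affine_fun \<tau> p w c v = L v + c" for c v
    by (simp add: L_def affine_fun_def)
  obtain J u where J: "J \<in> mappings \<tau> p" and u: "u \<in> coord_space \<tau> p"
    "\<And>i j. i \<in> {1..\<tau>} \<Longrightarrow> j \<in> {1..p i} \<Longrightarrow>
      0 \<le> Poly_Mapping.lookup u (i, j) \<and> Poly_Mapping.lookup u (i, j) \<le> Poly_Mapping.lookup x (i, j)"
    "\<And>i. i \<in> {1..\<tau>} \<Longrightarrow> (\<Sum>j=1..p i. Poly_Mapping.lookup u (i, j)) = \<zeta>"
    and Lu: "L u + b * \<zeta> = upper_bound \<tau> p w b J x \<zeta>"
    using upper_bound_attained[where w = w and b = b, OF x less_imp_le[OF \<zeta>(1)] less_imp_le[OF \<zeta>(2)]]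
    unfolding f_eq by blast
  \<comment> \<open>By (a) and \<open>0 \<le> y\<close>. This places \<open>y\<close> between the
    value at \<open>\<zeta> *\<^sub>R x\<close> and the value at \<open>u\<close>.\<close>
  have "\<zeta> * affine_fun \<tau> p w b x \<le> y"
  proof -
    have "\<zeta> * affine_fun \<tau> p w b x \<le> \<zeta> * y" using \<zeta> fy by simp
    also have "\<dots> \<le> 1 * y" using \<zeta> y0 by (intro mult_right_mono) auto
    finally show ?thesis by simp
  qed
  then have "y \<in> closed_segment (\<zeta> * affine_fun \<tau> p w b x) (L u + b * \<zeta>)"
    using ub[OF J] Lu by (simp add: closed_segment_eq_real_ivl)
  then obtain t where t: "0 \<le> t" "t \<le> 1"
    and y: "y = (1 - t) * (\<zeta> * affine_fun \<tau> p w b x) + t * (L u + b * \<zeta>)"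
    by (auto simp: closed_segment_def)
  \<comment> \<open>The mixing weight \<open>t\<close> makes the value at \<open>v\<close> equal to
    \<open>y\<close>, while \<open>v\<close> inherits the bounds 0 and \<open>x\<close> and the row
    sums \<open>\<zeta>\<close> from both ingredients.\<close>
  define v where "v = ((1 - t) * \<zeta>) *\<^sub>R x + t *\<^sub>R u"
  have lookup_v: "Poly_Mapping.lookup v k =
      (1 - t) * \<zeta> * Poly_Mapping.lookup x k + t * Poly_Mapping.lookup u k" for k
    by (simp add: v_def lookup_add)
  have Lv: "L v + b * \<zeta> = y"
  proof -
    have "L v = (1 - t) * \<zeta> * L x + t * L u"
      by (simp add: v_def linear_add[OF lin] linear_cmul[OF lin])
    then show ?thesis using y by (simp add: f_eq algebra_simps)
  qed
  have xc: "x \<in> coord_space \<tau> p" using x by (simp add: simplex_product_def)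
  have v_bounds: "0 \<le> Poly_Mapping.lookup v (i, j)" "Poly_Mapping.lookup v (i, j) \<le> Poly_Mapping.lookup x (i, j)"
    if "i \<in> {1..\<tau>}" "j \<in> {1..p i}" for i j
  proof -
    have x0: "0 \<le> Poly_Mapping.lookup x (i, j)" using simplex_product_nonneg[OF x that] .
    then show "0 \<le> Poly_Mapping.lookup v (i, j)"
      using u(2)[OF that] \<zeta> t by (simp add: lookup_v)
    have "\<zeta> * Poly_Mapping.lookup x (i, j) \<le> 1 * Poly_Mapping.lookup x (i, j)"
      using \<zeta> x0 by (intro mult_right_mono) auto
    then have "(1 - t) * (\<zeta> * Poly_Mapping.lookup x (i, j)) + t * Poly_Mapping.lookup u (i, j)
        \<le> Poly_Mapping.lookup x (i, j)"
      using u(2)[OF that] t by (intro convex_bound_le) auto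
    then show "Poly_Mapping.lookup v (i, j) \<le> Poly_Mapping.lookup x (i, j)"
      by (simp add: lookup_v mult.assoc)
  qed
  have v_sum: "(\<Sum>j=1..p i. Poly_Mapping.lookup v (i, j)) = \<zeta>" if "i \<in> {1..\<tau>}" for i
    using u(3)[OF that] simplex_product_sum[OF x that]
    by (simp add: lookup_v sum.distrib flip: sum_distrib_left) (simp add: algebra_simps)
  \<comment> \<open>Splitting \<open>x\<close> into \<open>v\<close> and \<open>x - v\<close> and
    rescaling the rows to mass 1 gives two points of the domain: \<open>v \<ge> 0\<close> serves
    \<open>x1\<close>, and \<open>v \<le> x\<close> serves \<open>x0\<close>.\<close>
  define x0 where "x0 = (1 / (1 - \<zeta>)) *\<^sub>R (x - v)"
  define x1 where "x1 = (1 / \<zeta>) *\<^sub>R v"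
  have vc: "v \<in> coord_space \<tau> p"
    using xc u(1) by (simp add: coord_space_iff lookup_v)
  have x1: "x1 \<in> simplex_product \<tau> p"
    using vc v_bounds(1) v_sum \<zeta>
    by (simp add: simplex_product_def coord_space_iff x1_def flip: sum_divide_distrib)
  have x0: "x0 \<in> simplex_product \<tau> p"
    using vc xc v_bounds(2) v_sum simplex_product_sum[OF x] \<zeta>
    by (simp add: simplex_product_def coord_space_iff x0_def lookup_minus sum_subtractf
        flip: sum_divide_distrib)
  have "affine_fun \<tau> p w b x1 = y / \<zeta>"
    using Lv \<zeta> by (simp add: x1_def f_eq linear_cmul[OF lin] field_simps)
  then have Q1: "(x1, y / \<zeta>, 1) \<in> relaxation \<tau> p w b"
    using x1 y0 \<zeta> by (simp add: relaxation_at_1_iff[OF inst])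
  have "affine_fun \<tau> p w b x0 = (L x - L v + b * (1 - \<zeta>)) / (1 - \<zeta>)"
    using \<zeta> by (simp add: x0_def f_eq linear_cmul[OF lin] linear_diff[OF lin] add_divide_distrib)
  also have "L x - L v + b * (1 - \<zeta>) = affine_fun \<tau> p w b x - y"
    using Lv by (simp add: f_eq algebra_simps)
  \<comment> \<open>This is where (a) enters: the part with z = 0 has a nonpositive affine
    value.\<close>
  also have "(affine_fun \<tau> p w b x - y) / (1 - \<zeta>) \<le> 0"
    using fy \<zeta> by (simp add: divide_nonpos_pos)
  finally have Q0: "(x0, 0, 0) \<in> relaxation \<tau> p w b"
    using x0 by (simp add: relaxation_at_0_iff[OF inst])
  have "(1 - \<zeta>) *\<^sub>R x0 + \<zeta> *\<^sub>R x1 = x"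
    using \<zeta> by (simp add: x0_def x1_def)
  moreover have "\<zeta> *\<^sub>R (1 :: real ^ 1) = z"
    by (simp add: vec_eq_iff \<zeta>_def)
  ultimately have "(x, y, z) = (1 - \<zeta>) *\<^sub>R (x0, 0, 0) + \<zeta> *\<^sub>R (x1, y / \<zeta>, 1)"
    using \<zeta> by simp
  \<comment> \<open>The endpoints are distinct because their last components are 0 and 1.\<close>
  then have "(x, y, z) \<in> open_segment (x0, 0, 0) (x1, y / \<zeta>, 1)"
    using \<zeta> by (auto simp: in_segment)
  then show ?thesis using that Q0 Q1 by (simp add: \<zeta>_def)
qed

lemma ideal_relaxation:
  assumes "relu_instance \<tau> p w b"
  shows "ideal_mip_formulation (coord_space \<tau> p) (relaxation \<tau> p w b) (relu_graph \<tau> p w b)"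
proof -
  have "z \<in> binary" if ext: "(x, y, z) extreme_point_of relaxation \<tau> p w b" for x y z
  proof (rule ccontr)
    assume "z \<notin> binary"
    moreover have Q: "(x, y, z) \<in> relaxation \<tau> p w b"
      using ext by (simp add: extreme_point_of_def)
    ultimately have "0 < z $ 1" "z $ 1 < 1"
      by (auto simp: binary_1_iff relaxation_iff less_le)
    from fractional_point_in_open_segment[OF assms Q this] show False
      using ext unfolding extreme_point_of_def by blast
  qed
  then show ?thesis
    using polyhedron_relaxation relu_graph_eq_projection[OF assms]
    by (auto simp: ideal_mip_formulation_def mip_formulation_def)
qed

section \<open>Non-redundancy\<close>

text \<open>Used in the contrapositive: mappings with different halfspaces choose different weights
  in some row.\<close>

lemma upper_halfspace_eq_if_weights_eq:
  assumes "relu_instance \<tau> p w b" "J \<in> mappings \<tau> p" "K \<in> mappings \<tau> p"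
    "\<And>i. i \<in> {1..\<tau>} \<Longrightarrow> w i (J i) = w i (K i)"
  shows "upper_halfspace \<tau> p w b J = upper_halfspace \<tau> p w b K"
proof -
  have "upper_bound \<tau> p w b J x z = upper_bound \<tau> p w b K x z" for x z
    unfolding upper_bound_eq_row_values
    using row_value_eq_if_weights_eq[OF relu_instance_mono[OF assms(1)] mappings_mem[OF assms(2)]
        mappings_mem[OF assms(3)] assms(4)]
    by (intro arg_cong2[where f = "(+)"] sum.cong refl)
  then show ?thesis by (simp add: upper_halfspace_def)
qed

text \<open>Inserting \<open>c + 1\<close> keeps the minimum defined when \<open>T\<close> is empty,
  which happens when all mappings define the same halfspace.\<close>

lemma finite_set_above_gap:
  fixes c :: real
  assumes "finite T" "\<And>t. t \<in> T \<Longrightarrow> c < t"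
  obtains y where "c < y" "\<And>t. t \<in> T \<Longrightarrow> y \<le> t"
  using assms by (intro that[of "Min (insert (c + 1) T)"]) simp_all

lemma upper_halfspace_not_redundant:
  assumes inst: "relu_instance \<tau> p w b" and J: "J \<in> mappings \<tau> p"
  shows "\<not> redundant_in (coord_space \<tau> p \<times> UNIV \<times> UNIV)
    (upper_halfspace \<tau> p w b ` mappings \<tau> p) (upper_halfspace \<tau> p w b J)"
proof -
  define H where "H = upper_halfspace \<tau> p w b"
  \<comment> \<open>The right-hand side of the constraint of \<open>J\<close> itself at the spike
    point with z = 1.\<close>
  define c where "c = (\<Sum>i=1..\<tau>. w i (J i)) + b"
  obtain x where x: "x \<in> coord_space \<tau> p"
    "\<And>i j. i \<in> {1..\<tau>} \<Longrightarrow> j \<in> {1..p i} \<Longrightarrow>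
      Poly_Mapping.lookup x (i, j) = (if j = J i then 2 else 0)"
    using point_with_coords[of \<tau> p "\<lambda>i j. if j = J i then 2 else 0"] by blast
  have ub: "upper_bound \<tau> p w b K x 1 = c + (\<Sum>i=1..\<tau>. \<bar>w i (K i) - w i (J i)\<bar>)"
    if K: "K \<in> mappings \<tau> p" for K
  proof -
    have "row_value (w i) (\<lambda>j. Poly_Mapping.lookup x (i, j)) 1 (p i) (K i) =
        w i (J i) + \<bar>w i (K i) - w i (J i)\<bar>" if i: "i \<in> {1..\<tau>}" for i
    proof -
      have "row_value (w i) (\<lambda>j. Poly_Mapping.lookup x (i, j)) 1 (p i) (K i) =
          row_value (w i) (\<lambda>l. if l = J i then 2 else 0) 1 (p i) (K i)"
        unfolding row_value_def using x(2)[OF i]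
        by (intro arg_cong2[where f = "(+)"] sum.cong refl) simp
      then show ?thesis
        using row_value_spike[OF relu_instance_mono[OF inst i] mappings_mem[OF J i] mappings_mem[OF K i]]
        by simp
    qed
    then show ?thesis
      by (simp add: upper_bound_eq_row_values sum.distrib c_def)
  qed
  have "c < upper_bound \<tau> p w b K x 1" if K: "K \<in> mappings \<tau> p" and "H K \<noteq> H J" for K
  proof -
    obtain i where i: "i \<in> {1..\<tau>}" "w i (K i) \<noteq> w i (J i)"
      using upper_halfspace_eq_if_weights_eq[OF inst K J] \<open>H K \<noteq> H J\<close> unfolding H_def by blast
    then have "0 < (\<Sum>i=1..\<tau>. \<bar>w i (K i) - w i (J i)\<bar>)"
      by (intro sum_pos2[of _ i]) auto
    then show ?thesis using ub[OF K] by simp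
  qed
  then have "\<And>t. t \<in> (\<lambda>K. upper_bound \<tau> p w b K x 1) ` {K \<in> mappings \<tau> p. H K \<noteq> H J} \<Longrightarrow> c < t"
    by blast
  \<comment> \<open>A value of \<open>y\<close> just above \<open>c\<close> violates the constraint
    of \<open>J\<close> and no constraint with another halfspace.\<close>
  then obtain y where y: "c < y"
    "\<And>t. t \<in> (\<lambda>K. upper_bound \<tau> p w b K x 1) ` {K \<in> mappings \<tau> p. H K \<noteq> H J} \<Longrightarrow> y \<le> t"
    using finite_set_above_gap[of "(\<lambda>K. upper_bound \<tau> p w b K x 1) ` {K \<in> mappings \<tau> p. H K \<noteq> H J}" c]
      finite_mappings[of \<tau> p] by (metis (no_types, lifting) finite_imageI finite_subset mem_Collect_eq subsetI)
  have "(x, y, 1) \<in> H K" if "K \<in> mappings \<tau> p" "H K \<noteq> H J" for K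
    using y(2) that x(1) by (simp add: H_def upper_halfspace_def)
  moreover have "(x, y, 1) \<notin> H J"
    using y(1) ub[OF J] by (simp add: H_def upper_halfspace_def)
  moreover have "(x, y, 1) \<in> coord_space \<tau> p \<times> UNIV \<times> (UNIV :: (real ^ 1) set)"
    using x(1) by simp
  ultimately show ?thesis
    using J unfolding redundant_in_def H_def[symmetric] by blast
qed

section \<open>Running times\<close>

definition runs :: "com \<Rightarrow> memory \<Rightarrow> nat \<Rightarrow> (memory \<Rightarrow> bool) \<Rightarrow> bool" where
  "runs c s n Q \<longleftrightarrow> (\<exists>t s'. exec c s t s' \<and> t \<le> n \<and> Q s')"

text \<open>
  Handing the unused time on to the postcondition makes straight-line code a matter of simplification.
\<close>

definition runs_left :: "com \<Rightarrow> nat \<Rightarrow> memory \<Rightarrow> (nat \<Rightarrow> memory \<Rightarrow> bool) \<Rightarrow> bool" where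
  "runs_left c n s Q \<longleftrightarrow> (\<exists>t s'. exec c s t s' \<and> t \<le> n \<and> Q (n - t) s')"

lemma runs_iff_runs_left: "runs c s n Q \<longleftrightarrow> runs_left c n s (\<lambda>_. Q)"
  by (simp add: runs_def runs_left_def)

text \<open>Determinism of execution turns the existential statement into an equivalence, which is
  safe for rewriting.\<close>

lemma runs_left_exec:
  assumes "exec c s t s'"
  shows "runs_left c n s Q \<longleftrightarrow> t \<le> n \<and> Q (n - t) s'"
  unfolding runs_left_def using assms exec_deterministic by blast

lemmas runs_left_Skip [simp] = runs_left_exec[OF exec.Skip]
lemmas runs_left_NAssign [simp] = runs_left_exec[OF exec.NAssign]
lemmas runs_left_RAssign [simp] = runs_left_exec[OF exec.RAssign]

lemma runs_left_Seq [simp]: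
  "runs_left (Seq c d) n s Q \<longleftrightarrow> runs_left c n s (\<lambda>m s'. runs_left d m s' Q)"
proof
  assume "runs_left (Seq c d) n s Q"
  then obtain t s' where "exec (Seq c d) s t s'" "t \<le> n" "Q (n - t) s'"
    by (auto simp: runs_left_def)
  then show "runs_left c n s (\<lambda>m s'. runs_left d m s' Q)"
    unfolding runs_left_def by (elim exec_SeqE) (fastforce simp: diff_diff_left)
next
  assume "runs_left c n s (\<lambda>m s'. runs_left d m s' Q)"
  then obtain t s1 t' s2 where "exec c s t s1" "t \<le> n" "exec d s1 t' s2" "t' \<le> n - t"
    "Q (n - t - t') s2"
    by (auto simp: runs_left_def)
  then show "runs_left (Seq c d) n s Q"
    unfolding runs_left_def
    by (intro exI[of _ "t + t'"] exI[of _ s2]) (auto intro: exec.Seq)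
qed

lemma runs_left_Cond [simp]:
  "runs_left (Cond g c d) n s Q \<longleftrightarrow>
     bcost g \<le> n \<and> runs_left (if bval g s then c else d) (n - bcost g) s Q"
proof
  assume "runs_left (Cond g c d) n s Q"
  then obtain t s' where "exec (Cond g c d) s t s'" "t \<le> n" "Q (n - t) s'"
    by (auto simp: runs_left_def)
  then show "bcost g \<le> n \<and> runs_left (if bval g s then c else d) (n - bcost g) s Q"
    unfolding runs_left_def by (elim exec_CondE) (fastforce simp: diff_diff_left)+
next
  assume "bcost g \<le> n \<and> runs_left (if bval g s then c else d) (n - bcost g) s Q"
  then obtain t s' where "bcost g \<le> n" "exec (if bval g s then c else d) s t s'"
    "t \<le> n - bcost g" "Q (n - bcost g - t) s'"
    by (auto simp: runs_left_def)
  then show "runs_left (Cond g c d) n s Q"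
    unfolding runs_left_def
    by (intro exI[of _ "bcost g + t"] exI[of _ s'])
      (auto intro: exec.CondTrue exec.CondFalse split: if_splits)
qed

lemma runs_Seq:
  assumes "runs c s m R" "\<And>s'. R s' \<Longrightarrow> runs d s' n Q"
  shows "runs (Seq c d) s (m + n) Q"
  using assms unfolding runs_def by (meson add_mono exec.Seq)

text \<open>The budget \<open>m i\<close> may vary with the iteration, as rows differ in length; the
  last \<open>bcost g\<close> pays for the failing test.\<close>

lemma runs_While_up:
  assumes step: "\<And>i s. a \<le> i \<Longrightarrow> i < N \<Longrightarrow> I i s \<Longrightarrow> bval g s \<and> runs c s (m i) (I (Suc i))"
    and stop: "\<And>s. I N s \<Longrightarrow> \<not> bval g s"
    and "a \<le> N" "I a s"
  shows "runs (While g c) s ((\<Sum>j=a..<N. bcost g + m j) + bcost g) (I N)"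
proof -
  have "runs (While g c) s ((\<Sum>j=i..<N. bcost g + m j) + bcost g) (I N)"
    if "i \<le> N" "a \<le> i" "I i s" for i s
    using that
  proof (induction i arbitrary: s rule: inc_induct)
    case base
    then show ?case
      unfolding runs_def using exec.WhileFalse[OF stop] by fastforce
  next
    case (step i)
    obtain t s1 where 1: "bval g s" "exec c s t s1" "t \<le> m i" "I (Suc i) s1"
      using assms(1)[OF step.prems(1) step.hyps(2) step.prems(2)] unfolding runs_def by blast
    obtain t' s2 where 2: "exec (While g c) s1 t' s2" "I N s2"
      "t' \<le> (\<Sum>j=Suc i..<N. bcost g + m j) + bcost g"
      using step.IH[OF le_SucI[OF step.prems(1)] 1(4)] unfolding runs_def by blast
    have "(\<Sum>j=i..<N. bcost g + m j) = bcost g + m i + (\<Sum>j=Suc i..<N. bcost g + m j)"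
      using step.hyps(2) by (rule sum.atLeast_Suc_lessThan)
    then show ?case
      unfolding runs_def using exec.WhileTrue[OF 1(1,2) 2(1)] 1(3) 2(2,3)
      by (intro exI[of _ "bcost g + t + t'"] exI[of _ s2]) simp
  qed
  then show ?thesis using assms(3,4) by blast
qed

text \<open>A loop whose counter falls to 0, reduced to the rising case by indexing the invariant
  with \<open>n - i\<close>.\<close>

lemma runs_While_down:
  assumes "\<And>k s. I (Suc k) s \<Longrightarrow> bval g s \<and> runs c s m (I k)"
    and "\<And>s. I 0 s \<Longrightarrow> \<not> bval g s" and "I n s"
  shows "runs (While g c) s (n * (bcost g + m) + bcost g) (I 0)"
proof -
  have "runs (While g c) s ((\<Sum>j=0..<n. bcost g + m) + bcost g) (I (n - n))"
  proof (rule runs_While_up[where I = "\<lambda>i. I (n - i)"])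
    show "bval g s \<and> runs c s m (I (n - Suc i))" if "i < n" "I (n - i) s" for i s
      using assms(1)[of "n - Suc i" s] that by (simp add: Suc_diff_Suc)
  qed (use assms in auto)
  then show ?thesis by simp
qed

lemma store_same [simp]: "store m a k v a k' = (if k' = k then v else m a k')"
  by (simp add: store_def)

lemma store_other [simp]: "a' \<noteq> a \<Longrightarrow> store m a k v a' = m a'"
  by (simp add: store_def)

section \<open>The separation program\<close>

text \<open>
  Scratch cells, all in array 3: naturals \<open>i\<close>, \<open>j\<close>, the offset of row \<open>i\<close> and the minimiser found so
  far in cells 0 to 3; reals \<open>\<Sum>\<^bsub>l>j\<^esub> x\<^bsub>i,l\<^esub>\<close>, \<open>\<Sum>\<^bsub>l>j\<^esub> w\<^bsub>i,l\<^esub> x\<^bsub>i,l\<^esub>\<close>, the minimum found so far, the sum of the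
  minima of the previous rows and the current row value in cells 0 to 4.
\<close>

abbreviation "nreg k \<equiv> NRead 3 (NConst k)"
abbreviation "rreg k \<equiv> RRead 3 (NConst k)"
abbreviation "w_cur \<equiv> RRead 1 (NAdd (nreg 2) (nreg 1))"
abbreviation "x_cur \<equiv> RRead 2 (NAdd (nreg 2) (nreg 1))"
abbreviation "z_in \<equiv> RRead 0 (NConst 2)"

text \<open>The value at \<open>j\<close> is computed before entry \<open>j\<close> joins the sums,
  because they range over \<open>l > j\<close>.\<close>

definition scan_step :: com where
  "scan_step =
    Seq (RAssign 3 (NConst 4) (RAdd (RMul w_cur (RSub z_in (rreg 0))) (rreg 1)))
    (Seq (Cond (RLess (rreg 4) (rreg 2))
            (Seq (RAssign 3 (NConst 2) (rreg 4)) (NAssign 3 (NConst 3) (nreg 1))) Skip)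
    (Seq (RAssign 3 (NConst 0) (RAdd (rreg 0) x_cur))
    (Seq (RAssign 3 (NConst 1) (RAdd (rreg 1) (RMul w_cur x_cur)))
         (NAssign 3 (NConst 1) (NSub (nreg 1) (NConst 1))))))"

text \<open>The search starts with the last index, whose suffix sums are empty and whose value is
  its weight times z.\<close>

definition row_init :: com where
  "row_init =
    Seq (NAssign 3 (NConst 1) (NRead 1 (nreg 0)))
    (Seq (NAssign 3 (NConst 3) (nreg 1))
    (Seq (RAssign 3 (NConst 0) (RConst 0))
    (Seq (RAssign 3 (NConst 1) (RConst 0))
         (RAssign 3 (NConst 2) (RMul w_cur z_in)))))"

definition row_exit :: com where
  "row_exit =
    Seq (NAssign 2 (nreg 0) (nreg 3))
    (Seq (RAssign 3 (NConst 3) (RAdd (rreg 3) (rreg 2)))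
    (Seq (NAssign 3 (NConst 2) (NAdd (nreg 2) (NRead 1 (nreg 0))))
         (NAssign 3 (NConst 0) (NAdd (nreg 0) (NConst 1)))))"

definition row_loop :: com where
  "row_loop = Seq row_init (Seq (While (NLess (NConst 0) (nreg 1)) scan_step) row_exit)"

text \<open>Starting the total at \<open>b * z\<close> makes it the full right-hand side of (b)
  after the last row.\<close>

definition separate_init :: com where
  "separate_init =
    Seq (NAssign 3 (NConst 0) (NConst 1))
    (Seq (NAssign 3 (NConst 2) (NConst 0))
         (RAssign 3 (NConst 3) (RMul (RRead 0 (NConst 0)) z_in)))"

definition separate_exit :: com where
  "separate_exit =
    Cond (RLess (rreg 3) (RRead 0 (NConst 1)))
      (NAssign 2 (NConst 0) (NConst 1)) (NAssign 2 (NConst 0) (NConst 0))"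

definition separate :: com where
  "separate = Seq separate_init
    (Seq (While (BNot (NLess (NRead 0 (NConst 0)) (nreg 0))) row_loop) separate_exit)"

section \<open>Invariants, correctness and linear running time of the separation program\<close>

text \<open>Indices above \<open>k\<close> have been scanned. The equations with \<open>s0\<close>,
  the memory at the start of the row, record what the scan leaves untouched.\<close>

definition scan_inv ::
    "memory \<Rightarrow> (nat \<Rightarrow> real) \<Rightarrow> (nat \<Rightarrow> real) \<Rightarrow> real \<Rightarrow> nat \<Rightarrow> nat \<Rightarrow> memory \<Rightarrow> bool" where
  "scan_inv s0 w x z n k s \<longleftrightarrow>
     nats s 0 = nats s0 0 \<and> nats s 1 = nats s0 1 \<and> nats s 2 = nats s0 2 \<and>
     nats s 3 0 = nats s0 3 0 \<and> nats s 3 2 = nats s0 3 2 \<and>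
     reals s 0 = reals s0 0 \<and> reals s 1 = reals s0 1 \<and> reals s 2 = reals s0 2 \<and>
     reals s 3 3 = reals s0 3 3 \<and>
     nats s 3 1 = k \<and> k \<le> n \<and>
     reals s 3 0 = (\<Sum>l=k+1..n. x l) \<and> reals s 3 1 = (\<Sum>l=k+1..n. w l * x l) \<and>
     nats s 3 3 \<in> {1..n} \<and> reals s 3 2 = row_value w x z n (nats s 3 3) \<and>
     (\<forall>l\<in>{k+1..n}. reals s 3 2 \<le> row_value w x z n l)"

lemma scan_step_runs:
  assumes w: "\<And>l. l \<in> {1..n} \<Longrightarrow> reals s0 1 (nats s0 3 2 + l) = w l"
    and x: "\<And>l. l \<in> {1..n} \<Longrightarrow> reals s0 2 (nats s0 3 2 + l) = x l"
    and z: "reals s0 0 2 = z" and inv: "scan_inv s0 w x z n (Suc k) s"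
  shows "runs scan_step s 70 (scan_inv s0 w x z n k)"
proof -
  have k: "Suc k \<in> {1..n}" using inv by (simp add: scan_inv_def)
  have sums: "(\<Sum>l=Suc k..n. f l) = (\<Sum>l=Suc (Suc k)..n. f l) + f (Suc k)" for f :: "nat \<Rightarrow> real"
    using k by (simp add: sum.atLeast_Suc_atMost)
  \<comment> \<open>The right-hand side is the expression that the program evaluates; it is folded
    back into a row value.\<close>
  have val: "row_value w x z n (Suc k) =
      w (Suc k) * (z - (\<Sum>l=Suc (Suc k)..n. x l)) + (\<Sum>l=Suc (Suc k)..n. w l * x l)"
    by (simp add: row_value_eq_suffix_sums)
  have all: "(\<forall>l\<in>{Suc k..n}. P l) \<longleftrightarrow> P (Suc k) \<and> (\<forall>l\<in>{Suc (Suc k)..n}. P l)" for P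
    using k by (auto simp: atLeastAtMost_insertL[symmetric])
  show ?thesis
    using inv w[OF k] x[OF k] z k
    by (auto simp: runs_iff_runs_left scan_step_def scan_inv_def sums all val[symmetric])
qed

lemma row_loop_runs:
  assumes w: "\<And>l. l \<in> {1..n} \<Longrightarrow> reals s 1 (nats s 3 2 + l) = w l"
    and x: "\<And>l. l \<in> {1..n} \<Longrightarrow> reals s 2 (nats s 3 2 + l) = x l"
    and z: "reals s 0 2 = z" and n: "nats s 1 (nats s 3 0) = n" "1 \<le> n"
  shows "runs row_loop s (74 * n + 64) (\<lambda>s'. \<exists>j\<in>{1..n}.
     (\<forall>l\<in>{1..n}. row_value w x z n j \<le> row_value w x z n l) \<and>
     nats s' 0 = nats s 0 \<and> nats s' 1 = nats s 1 \<and> nats s' 2 = (nats s 2)(nats s 3 0 := j) \<and>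
     nats s' 3 0 = nats s 3 0 + 1 \<and> nats s' 3 2 = nats s 3 2 + n \<and>
     reals s' 0 = reals s 0 \<and> reals s' 1 = reals s 1 \<and> reals s' 2 = reals s 2 \<and>
     reals s' 3 3 = reals s 3 3 + row_value w x z n j)"
    (is "runs _ _ _ ?Q")
proof -
  have init: "runs row_init s 30 (scan_inv s w x z n n)"
    using w[of n] z n by (simp add: runs_iff_runs_left row_init_def scan_inv_def row_value_def)
  have loop: "runs (While (NLess (NConst 0) (nreg 1)) scan_step) s1 (n * (4 + 70) + 4) (scan_inv s w x z n 0)"
    if "scan_inv s w x z n n s1" for s1
  proof -
    have "runs (While (NLess (NConst 0) (nreg 1)) scan_step) s1
        (n * (bcost (NLess (NConst 0) (nreg 1)) + 70) + bcost (NLess (NConst 0) (nreg 1)))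
        (scan_inv s w x z n 0)"
    proof (rule runs_While_down)
      show "bval (NLess (NConst 0) (nreg 1)) s2 \<and> runs scan_step s2 70 (scan_inv s w x z n k)"
        if "scan_inv s w x z n (Suc k) s2" for k s2
        using scan_step_runs[OF w x z that] that by (simp add: scan_inv_def)
    qed (use that in \<open>simp_all add: scan_inv_def\<close>)
    then show ?thesis by (simp del: One_nat_def)
  qed
  have exit: "runs row_exit s1 30 ?Q" if "scan_inv s w x z n 0 s1" for s1
    using that n
    by (auto simp: runs_iff_runs_left row_exit_def scan_inv_def store_def
        intro!: bexI[of _ "nats s1 3 3"])
  \<comment> \<open>Each entry costs 4 for the loop test and at most 70 for the body; entry, final
    test and exit account for the 64.\<close>
  have "runs row_loop s (30 + (n * (4 + 70) + 4 + 30)) ?Q"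
    unfolding row_loop_def by (intro runs_Seq[OF init] runs_Seq[OF loop] exit)
  then show ?thesis by (simp add: algebra_simps)
qed

text \<open>Rows before \<open>i\<close> are finished: their minimisers are in the output array, and
  scratch cell 2 holds the offset of row \<open>i\<close> used by \<open>cell\<close>.\<close>

definition rows_inv ::
    "memory \<Rightarrow> nat \<Rightarrow> (nat \<Rightarrow> nat) \<Rightarrow> (nat \<Rightarrow> nat \<Rightarrow> real) \<Rightarrow> real \<Rightarrow> point \<Rightarrow> real \<Rightarrow> nat \<Rightarrow> memory \<Rightarrow> bool" where
  "rows_inv s0 \<tau> p w b x z i s \<longleftrightarrow>
     nats s 0 = nats s0 0 \<and> nats s 1 = nats s0 1 \<and>
     reals s 0 = reals s0 0 \<and> reals s 1 = reals s0 1 \<and> reals s 2 = reals s0 2 \<and>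
     nats s 3 0 = i \<and> nats s 3 2 = (\<Sum>k=1..<i. p k) \<and>
     (\<forall>k\<in>{1..<i}. nats s 2 k \<in> {1..p k} \<and>
        (\<forall>l\<in>{1..p k}.
           row_value (w k) (\<lambda>j. Poly_Mapping.lookup x (k, j)) z (p k) (nats s 2 k) \<le>
           row_value (w k) (\<lambda>j. Poly_Mapping.lookup x (k, j)) z (p k) l)) \<and>
     reals s 3 3 = b * z +
       (\<Sum>k=1..<i. row_value (w k) (\<lambda>j. Poly_Mapping.lookup x (k, j)) z (p k) (nats s 2 k))"

lemma rows_inv_step:
  assumes inp: "holds_input s0 \<tau> p w b x y z" and p: "\<And>i. i \<in> {1..\<tau>} \<Longrightarrow> 1 \<le> p i"
    and i: "i \<in> {1..\<tau>}" and inv: "rows_inv s0 \<tau> p w b x z i s"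
  shows "runs row_loop s (74 * p i + 64) (rows_inv s0 \<tau> p w b x z (Suc i))"
proof -
  let ?r = "\<lambda>k. row_value (w k) (\<lambda>j. Poly_Mapping.lookup x (k, j)) z (p k)"
  have same: "nats s 0 = nats s0 0" "nats s 1 = nats s0 1" "reals s 0 = reals s0 0"
      "reals s 1 = reals s0 1" "reals s 2 = reals s0 2" "nats s 3 0 = i"
      "nats s 3 2 = (\<Sum>k=1..<i. p k)"
    and mins: "\<And>k. k \<in> {1..<i} \<Longrightarrow> nats s 2 k \<in> {1..p k} \<and> (\<forall>l\<in>{1..p k}. ?r k (nats s 2 k) \<le> ?r k l)"
    and total: "reals s 3 3 = b * z + (\<Sum>k=1..<i. ?r k (nats s 2 k))"
    using inv unfolding rows_inv_def by blast+
  have w: "reals s 1 (nats s 3 2 + l) = w i l" if "l \<in> {1..p i}" for l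
    using inp i that same by (auto simp: holds_input_def idx_def cell_def)
  have x: "reals s 2 (nats s 3 2 + l) = Poly_Mapping.lookup x (i, l)" if "l \<in> {1..p i}" for l
    using inp i that same by (auto simp: holds_input_def idx_def cell_def)
  have z: "reals s 0 2 = z" and n: "nats s 1 (nats s 3 0) = p i"
    using inp i same by (auto simp: holds_input_def)
  obtain t s' j where s': "exec row_loop s t s'" "t \<le> 74 * p i + 64" "j \<in> {1..p i}"
    "\<And>l. l \<in> {1..p i} \<Longrightarrow> ?r i j \<le> ?r i l"
    "nats s' 0 = nats s 0" "nats s' 1 = nats s 1" "nats s' 2 = (nats s 2)(i := j)"
    "nats s' 3 0 = i + 1" "nats s' 3 2 = nats s 3 2 + p i"
    "reals s' 0 = reals s 0" "reals s' 1 = reals s 1" "reals s' 2 = reals s 2"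
    "reals s' 3 3 = reals s 3 3 + ?r i j"
    using row_loop_runs[OF w x z n p[OF i]] unfolding runs_def same(6) by blast
  have i1: "1 \<le> i" using i by simp
  have "(\<Sum>k=1..<i. ?r k (nats s' 2 k)) = (\<Sum>k=1..<i. ?r k (nats s 2 k))"
    by (rule sum.cong) (auto simp: s'(7))
  then have total': "reals s' 3 3 = b * z + (\<Sum>k=1..<Suc i. ?r k (nats s' 2 k))"
    using i1 total s'(7,13) by simp
  have mins': "nats s' 2 k \<in> {1..p k} \<and> (\<forall>l\<in>{1..p k}. ?r k (nats s' 2 k) \<le> ?r k l)"
    if "k \<in> {1..<Suc i}" for k
  proof (cases "k = i")
    case True
    then show ?thesis using s'(3,4,7) by simp
  next
    case False
    then show ?thesis using mins[of k] that s'(7) by simp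
  qed
  have "nats s' 3 2 = (\<Sum>k=1..<Suc i. p k)"
    using i1 same(7) s'(9) by simp
  then have "rows_inv s0 \<tau> p w b x z (Suc i) s'"
    unfolding rows_inv_def using total' mins' same(1-5) s'(5,6,8,10-12) by simp
  then show ?thesis unfolding runs_def using s'(1,2) by blast
qed

lemma separate_runs:
  assumes inst: "relu_instance \<tau> p w b" and inp: "holds_input s \<tau> p w b x y z"
  shows "runs separate s (200 * (\<Sum>i=1..\<tau>. p i)) (\<lambda>s'. holds_output s' \<tau> p w b x y z)"
proof -
  let ?I = "rows_inv s \<tau> p w b x z"
  let ?g = "BNot (NLess (NRead 0 (NConst 0)) (nreg 0))"
  note p = relu_instance_p_pos[OF inst]
  have \<tau>: "nats s 0 0 = \<tau>" using inp by (simp add: holds_input_def)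
  have init: "runs separate_init s 20 (?I 1)"
    using inp by (simp add: runs_iff_runs_left separate_init_def rows_inv_def holds_input_def)
  have loop: "runs (While ?g row_loop) s1
      ((\<Sum>i=1..<Suc \<tau>. bcost ?g + (74 * p i + 64)) + bcost ?g) (?I (Suc \<tau>))"
    if "?I 1 s1" for s1
  proof (rule runs_While_up)
    show "bval ?g s2 \<and> runs row_loop s2 (74 * p i + 64) (?I (Suc i))"
      if "1 \<le> i" "i < Suc \<tau>" "?I i s2" for i s2
      using rows_inv_step[OF inp p _ that(3)] that \<tau> by (simp add: rows_inv_def)
    show "\<not> bval ?g s2" if "?I (Suc \<tau>) s2" for s2
      using that \<tau> by (simp add: rows_inv_def)
  qed (use that in simp_all)
  have exit: "runs separate_exit s1 10 (\<lambda>s'. holds_output s' \<tau> p w b x y z)"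
    if inv: "?I (Suc \<tau>) s1" for s1
  proof -
    let ?r = "\<lambda>k. row_value (w k) (\<lambda>j. Poly_Mapping.lookup x (k, j)) z (p k)"
    define J where "J = restrict (nats s1 2) {1..\<tau>}"
    have mins: "\<And>k. k \<in> {1..\<tau>} \<Longrightarrow> J k \<in> {1..p k} \<and> (\<forall>l\<in>{1..p k}. ?r k (J k) \<le> ?r k l)"
      and total: "reals s1 3 3 = upper_bound \<tau> p w b J x z"
      using inv
      by (simp_all add: rows_inv_def J_def upper_bound_eq_row_values atLeastLessThanSuc_atLeastAtMost)
    have J: "J \<in> mappings \<tau> p"
      using mins by (auto simp: mappings_def J_def)
    \<comment> \<open>The choices in different rows are independent, so rowwise minimisers form a
      minimising mapping. A violated constraint thus exists exactly if that of \<open>J\<close> is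
      violated.\<close>
    have min: "upper_bound \<tau> p w b J x z \<le> upper_bound \<tau> p w b K x z" if "K \<in> mappings \<tau> p" for K
      unfolding upper_bound_eq_row_values
      using mins mappings_mem[OF that] by (intro add_mono sum_mono) auto
    then have violated: "(\<exists>K\<in>mappings \<tau> p. upper_bound \<tau> p w b K x z < y) \<longleftrightarrow>
        upper_bound \<tau> p w b J x z < y"
      using J by (meson order_le_less_trans)
    have y: "reals s1 0 (Suc 0) = y"
      using inv inp by (simp add: rows_inv_def holds_input_def)
    \<comment> \<open>The flag sits in cell 0, outside the cells \<open>1, ..., \<tau>\<close> of
      the mapping.\<close>
    have J_store: "restrict (store (nats s1) 2 0 v 2) {1..\<tau>} = J" for v
      by (auto simp: J_def restrict_def)
    show ?thesis
      using J min J_store[of 1]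
      by (simp add: runs_iff_runs_left separate_exit_def holds_output_def most_violated_def violated
          y total)
  qed
  have "runs separate s
      (20 + (((\<Sum>i=1..<Suc \<tau>. bcost ?g + (74 * p i + 64)) + bcost ?g) + 10))
      (\<lambda>s'. holds_output s' \<tau> p w b x y z)"
    unfolding separate_def by (intro runs_Seq[OF init] runs_Seq[OF loop] exit)
  moreover have "20 + (((\<Sum>i=1..<Suc \<tau>. bcost ?g + (74 * p i + 64)) + bcost ?g) + 10) \<le>
      200 * (\<Sum>i=1..\<tau>. p i)"
  proof -
    \<comment> \<open>Without rows the function would be constant and could not take both signs.
      Together with nonempty rows this lets the sum of the \<open>p i\<close> absorb the costs per
      row and the fixed costs.\<close>
    have "\<tau> \<noteq> 0"
    proof
      assume "\<tau> = 0"
      then show False using inst by (auto simp: relu_instance_def affine_fun_def)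
    qed
    have "\<tau> = (\<Sum>i=1..\<tau>. 1)" by simp
    also have "\<dots> \<le> (\<Sum>i=1..\<tau>. p i)" using p by (intro sum_mono) auto
    finally have "\<tau> \<le> (\<Sum>i=1..\<tau>. p i)" .
    then show ?thesis
      using \<open>\<tau> \<noteq> 0\<close>
      by (simp add: sum.distrib atLeastLessThanSuc_atLeastAtMost flip: sum_distrib_left)
  qed
  ultimately show ?thesis
    unfolding runs_def by (meson order_trans)
qed

theorem corollary5:
  shows "(\<forall>\<tau> p w b. relu_instance \<tau> p w b \<longrightarrow>
            ideal_mip_formulation (coord_space \<tau> p) (relaxation \<tau> p w b) (relu_graph \<tau> p w b) \<and>
            (\<forall>J\<in>mappings \<tau> p.
               \<not> redundant_in (coord_space \<tau> p \<times> UNIV \<times> UNIV)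
                    (upper_halfspace \<tau> p w b ` mappings \<tau> p) (upper_halfspace \<tau> p w b J)))
       \<and> (\<exists>prog C. \<forall>\<tau> p w b x y z s.
            relu_instance \<tau> p w b \<and> x \<in> coord_space \<tau> p \<and> holds_input s \<tau> p w b x y z \<longrightarrow>
            (\<exists>t s'. exec prog s t s' \<and> t \<le> C * (\<Sum>i=1..\<tau>. p i) \<and>
               holds_output s' \<tau> p w b x y z))"
proof (rule conjI)
  show "\<forall>\<tau> p w b. relu_instance \<tau> p w b \<longrightarrow>
      ideal_mip_formulation (coord_space \<tau> p) (relaxation \<tau> p w b) (relu_graph \<tau> p w b) \<and>
      (\<forall>J\<in>mappings \<tau> p.
         \<not> redundant_in (coord_space \<tau> p \<times> UNIV \<times> UNIV)
              (upper_halfspace \<tau> p w b ` mappings \<tau> p) (upper_halfspace \<tau> p w b J))"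
    using ideal_relaxation upper_halfspace_not_redundant by blast
  show "\<exists>prog C. \<forall>\<tau> p w b x y z s.
      relu_instance \<tau> p w b \<and> x \<in> coord_space \<tau> p \<and> holds_input s \<tau> p w b x y z \<longrightarrow>
      (\<exists>t s'. exec prog s t s' \<and> t \<le> C * (\<Sum>i=1..\<tau>. p i) \<and> holds_output s' \<tau> p w b x y z)"
    \<comment> \<open>The witnesses are \<open>separate\<close> and 200, both independent of the
      instance.\<close>
    using separate_runs unfolding runs_def by blast
qed

end
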